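(* Expected codimension is a valuative matroid invariant: for every $n$, the function $M\mapsto\operatorname{ec}(M)$ from the set of all matroids on $[n]=\{1,\dots,n\}$ to $\mathbb{Z}$ is valuative. That is, for every matroid $M$ on $[n]$ and every matroidal subdivision $\mathcal{D}$ of the matroid polytope $P(M)$, $$\operatorname{ec}(M)=\sum_{P(N)\in\mathcal{D}_{in}}(-1)^{\dim P(M)-\dim P(N)}\operatorname{ec}(N).$$
   Context: Expected codimension: let $M$ be a matroid of rank $k$ on a finite set $E$ with rank function $\operatorname{rk}$. For $S\subseteq E$ put $c(S)=\#S-\operatorname{rk}S$, and define $a(S)$ recursively for all $S\subseteq E$ by $a(S)=c(S)-\sum_{T\subsetneq S}a(T)$, $a(\varnothing)=0$. Then $\operatorname{ec}(M)=\sum_{S\subseteq E}(k-\operatorname{rk}S)\,a(S)$. Matroid polytope: for a matroid $M$ on $[n]$, $P(M)\subset\mathbb{R}^n$ is the convex hull of the indicator vectors (entries 1 on $B$, 0 elsewhere) of the bases $B$ of $M$. A matroidal subdivision $\mathcal{D}$ of $P(M)$ is a decomposition of $P(M)$ into polytopes (a polyhedral complex whose union is $P(M)$), all of which are matroid polytopes of matroids on $[n]$. $\mathcal{D}_{in}$ denotes the set of internal faces of $\mathcal{D}$, i.e. the faces (of all dimensions, including the maximal cells) of $\mathcal{D}$ that are not contained in the relative boundary of $P(M)$. A function $f$ from the set of all matroids on $[n]$ to an abelian group is valuative if $f(M)=\sum_{P(N)\in\mathcal{D}_{in}}(-1)^{\dim P(M)-\dim P(N)}f(N)$ for every matroid $M$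 on $[n]$ and every matroidal subdivision $\mathcal{D}$ of $P(M)$. *)

theory Defs
  imports "HOL-Analysis.Analysis"
begin

section \<open>Matroids given by their bases\<close>

definition matroid_on :: "'a set \<Rightarrow> 'a set set \<Rightarrow> bool" where
  "matroid_on E \<B> \<longleftrightarrow>
     finite E \<and> \<B> \<noteq> {} \<and> (\<forall>B\<in>\<B>. B \<subseteq> E) \<and>
     (\<forall>A\<in>\<B>. \<forall>B\<in>\<B>. \<forall>x\<in>A - B. \<exists>y\<in>B - A. insert y (A - {x}) \<in> \<B>)"

definition indep_in :: "'a set set \<Rightarrow> 'a set \<Rightarrow> bool" where
  "indep_in \<B> I \<longleftrightarrow> (\<exists>B\<in>\<B>. I \<subseteq> B)"

definition matroid_rank :: "'a set set \<Rightarrow> 'a set \<Rightarrow> nat" where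
  "matroid_rank \<B> S = Max (card ` {I. I \<subseteq> S \<and> indep_in \<B> I})"


section \<open>Expected codimension\<close>

definition nullity :: "'a set set \<Rightarrow> 'a set \<Rightarrow> int" where
  "nullity \<B> S = int (card S) - int (matroid_rank \<B> S)"

function a_coeff :: "'a::finite set set \<Rightarrow> 'a set \<Rightarrow> int" where
  "a_coeff \<B> S = nullity \<B> S - (\<Sum>T | T \<subset> S. a_coeff \<B> T)"
  by pat_completeness auto
termination
  by (relation "Wellfounded.measure (\<lambda>(\<B>, S). card S)") (auto intro: psubset_card_mono)

declare a_coeff.simps [simp del]

lemma a_coeff_empty: "matroid_on E \<B> \<Longrightarrow> a_coeff \<B> {} = 0"
proof -
  assume "matroid_on E \<B>"
  then have "{I. I \<subseteq> {} \<and> indep_in \<B> I} = {{}}"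
    by (auto simp: matroid_on_def indep_in_def)
  then show ?thesis
    by (subst a_coeff.simps) (simp add: nullity_def matroid_rank_def)
qed

definition ec :: "'a::finite set \<Rightarrow> 'a set set \<Rightarrow> int" where
  "ec E \<B> = (\<Sum>S\<in>Pow E. (int (matroid_rank \<B> E) - int (matroid_rank \<B> S)) * a_coeff \<B> S)"

text \<open>Invariance under isomorphism, i.e. under relabelling of the ground set.\<close>

definition matroid_invariant :: "('a set \<Rightarrow> 'a set set \<Rightarrow> 'b) \<Rightarrow> bool" where
  "matroid_invariant f \<longleftrightarrow>
     (\<forall>E E' \<phi> \<B>. matroid_on E \<B> \<and> bij_betw \<phi> E E' \<longrightarrow> f E' ((`) \<phi> ` \<B>) = f E \<B>)"


section \<open>Matroid polytopes and matroidal subdivisions\<close>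

text \<open>
  The ground set \<open>E\<close> is an arbitrary subset of a finite type \<open>'n\<close>. The polytope of a matroid
  on \<open>E\<close> lies in the coordinate subspace of \<open>real ^ 'n\<close> belonging to \<open>E\<close>. The case of the ground
  set \<open>{1, \<dots>, n}\<close> is \<open>E = UNIV\<close> with \<open>CARD('n) = n\<close>; for \<open>n = 0\<close>, which no index type provides,
  it is \<open>E = {}\<close>. Faces, dimension and relative boundary do not depend on the ambient space.
\<close>

definition indicator_vec :: "'n::finite set \<Rightarrow> real ^ 'n" where
  "indicator_vec B = (\<chi> i. if i \<in> B then 1 else 0)"

definition matroid_polytope :: "'n::finite set set \<Rightarrow> (real ^ 'n) set" where
  "matroid_polytope \<B> = convex hull (indicator_vec ` \<B>)"

text \<open>
  A polyhedral complex consists here of nonempty cells. The library's \<^const>\<open>face_of\<close> counts the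
  empty set as a face of everything, so it is excluded in the condition on faces and admitted in
  the condition on intersections.
\<close>

definition polytopal_subdivision ::
    "('a::euclidean_space) set set \<Rightarrow> 'a set \<Rightarrow> bool" where
  "polytopal_subdivision \<D> P \<longleftrightarrow>
     finite \<D> \<and>
     (\<forall>C\<in>\<D>. polytope C \<and> C \<noteq> {}) \<and>
     (\<forall>C\<in>\<D>. \<forall>F. F face_of C \<and> F \<noteq> {} \<longrightarrow> F \<in> \<D>) \<and>
     (\<forall>C\<in>\<D>. \<forall>C'\<in>\<D>. C \<inter> C' face_of C \<and> C \<inter> C' face_of C') \<and>
     \<Union>\<D> = P"

definition matroidal_subdivision ::
    "'n::finite set \<Rightarrow> (real ^ 'n) set set \<Rightarrow> (real ^ 'n) set \<Rightarrow> bool" where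
  "matroidal_subdivision E \<D> P \<longleftrightarrow>
     polytopal_subdivision \<D> P \<and>
     (\<forall>C\<in>\<D>. \<exists>\<N>. matroid_on E \<N> \<and> C = matroid_polytope \<N>)"

definition internal_faces :: "('a::euclidean_space) set set \<Rightarrow> 'a set \<Rightarrow> 'a set set" where
  "internal_faces \<D> P = {C \<in> \<D>. \<not> C \<subseteq> rel_frontier P}"


section \<open>Valuative functions\<close>

text \<open>
  A matroid is determined by its polytope, so summing over the matroids \<open>\<N>\<close> amounts to summing
  over the internal faces. The sign \<open>(-1) ^ (dim P(M) - dim P(N))\<close> is written as a
  case distinction because an abelian group has no element \<open>-1\<close>.
\<close>

definition valuative :: "'n::finite set \<Rightarrow> ('n set set \<Rightarrow> 'g::ab_group_add) \<Rightarrow> bool" where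
  "valuative E f \<longleftrightarrow>
     (\<forall>\<M> \<D>. matroid_on E \<M> \<and> matroidal_subdivision E \<D> (matroid_polytope \<M>) \<longrightarrow>
        f \<M> =
          (\<Sum>\<N> | matroid_on E \<N> \<and>
                 matroid_polytope \<N> \<in> internal_faces \<D> (matroid_polytope \<M>).
             if even (aff_dim (matroid_polytope \<M>) - aff_dim (matroid_polytope \<N>))
             then f \<N> else - f \<N>))"

end

theory Submission
  imports Defs
begin

text \<open>
  Moebius inversion of the recursion for \<open>a(S)\<close> turns the expected codimension into
  \<open>ec(M) = \<Sum> (-1) ^ (|S| - |T|) (k - rk S) (|T| - rk T)\<close>, summed over \<open>T \<subseteq> S \<subseteq> E\<close>,
  an integral combination of functions of the ranks of the two members of a chain
  \<open>T \<subseteq> S\<close>. This formula is visibly invariant under relabelling. As all matroids of a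
  subdivision of \<open>P(M)\<close> have the rank \<open>k\<close> of \<open>M\<close>, valuativity follows once every function
  \<open>g(rk T, rk S)\<close> is known to satisfy the valuative identity (\<open>flag_rank_valuative\<close>).

  The greedy principle provides one basis that meets both \<open>T\<close> and \<open>S\<close> in as many elements as
  possible (\<open>matroid_rank_chain_attained\<close>). With a number \<open>N\<close> larger than every rank, the
  linear form \<open>w\<close> with coefficient vector \<open>N e\<^sub>T + e\<^sub>S\<close> therefore has maximum
  \<open>N rk T + rk S\<close> on the matroid polytope, and both ranks can be read off from it by division
  with remainder. So it suffices that, for a linear form \<open>w\<close> and any function \<open>\<phi>\<close> of a real
  variable, \<open>\<phi>(max w)\<close> is valuative. This is a fact about arbitrary polytopal subdivisions
  (\<open>sum_sup_on_internal_faces\<close>), and its proof is the heart of the matter.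

  The relative interiors of the internal faces partition the relative interior of \<open>P\<close> into
  bounded relatively open convex sets. Let \<open>V\<close> be a set of this kind partitioned into such
  sets \<open>U\<close>, and let \<open>e(U) = (-1) ^ dim U\<close>. The claim \<open>\<Sum> e(U) \<phi>(sup w on U) = e(V) \<phi>(sup w on V)\<close>
  is proved by induction on \<open>dim V\<close>, sweeping the level hyperplanes of \<open>w\<close> through \<open>V\<close>. Each level
  hyperplane cuts the partition of \<open>V\<close> into a partition of the slice of \<open>V\<close>, so the signs of the
  slices of the pieces add up to the sign of the slice of \<open>V\<close>. When the level rises to \<open>t\<close> from
  just below, the sign of the slice of \<open>U\<close> changes by \<open>e(U)\<close> if the supremum of \<open>w\<close> on \<open>U\<close>
  is \<open>t\<close>, and not at all otherwise (\<open>slice_sign_jump\<close>). Comparing the jumps shows that the signs of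
  the pieces with supremum \<open>t\<close> sum to \<open>e(V)\<close> if \<open>t\<close> is the supremum on \<open>V\<close>, and to \<open>0\<close> if not.
  Relatively open pieces make the induction self-contained: slices are again of this kind,
  whereas slicing a polyhedral complex would require a description of the faces of the slices.
\<close>


section \<open>Partitions into relatively open convex cells\<close>

definition open_cell :: "'a::euclidean_space set \<Rightarrow> bool" where
  "open_cell U \<longleftrightarrow> U \<noteq> {} \<and> convex U \<and> rel_open U \<and> bounded U"

definition euler_sign :: "'a::euclidean_space set \<Rightarrow> int" where
  "euler_sign U = (if even (aff_dim U) then 1 else - 1)"

definition sup_on :: "'a::euclidean_space \<Rightarrow> 'a set \<Rightarrow> real" where
  "sup_on a U = Sup ((\<bullet>) a ` U)"

definition inf_on :: "'a::euclidean_space \<Rightarrow> 'a set \<Rightarrow> real" where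
  "inf_on a U = Inf ((\<bullet>) a ` U)"

abbreviation level :: "'a::euclidean_space \<Rightarrow> real \<Rightarrow> 'a set" where
  "level a s \<equiv> {x. a \<bullet> x = s}"

text \<open>
  This dichotomy, applied to the values of a linear form, decides which level hyperplanes meet
  a cell: a form constant on the cell has a single level, and any other form attains exactly the
  values strictly between its infimum and its supremum.
\<close>

lemma open_cell_real:
  fixes X :: "real set"
  assumes "open_cell X"
  shows "(Inf X = Sup X \<and> X = {Sup X}) \<or> (Inf X < Sup X \<and> X = {Inf X<..<Sup X})"
proof (cases "\<exists>x. X = {x}")
  case True
  then show ?thesis by auto
next
  case False
  have X: "X \<noteq> {}" "convex X" "rel_open X" and bd: "bdd_above X" "bdd_below X"
    using assms unfolding open_cell_def
    by (auto intro: bounded_imp_bdd_above bounded_imp_bdd_below)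
  have "aff_dim X \<noteq> -1" "aff_dim X \<noteq> 0"
    using X(1) False aff_dim_empty[of X] aff_dim_eq_0[of X] by blast+
  then have "aff_dim X = DIM(real)"
    using aff_dim_geq[of X] aff_dim_le_DIM[of X] by simp
  then have "affine hull X = UNIV"
    using aff_dim_eq_full by blast
  then have op: "open X"
    using X(3) by (simp add: rel_open)
  have int: "is_interval X"
    using X(2) by (simp add: is_interval_convex_1)
  have "X = {Inf X<..<Sup X}"
  proof (intro set_eqI iffI)
    fix x assume x: "x \<in> X"
    then obtain e where e: "e > 0" "ball x e \<subseteq> X"
      using op open_contains_ball by blast
    have "x + e/2 \<in> X" "x - e/2 \<in> X"
      using e by (auto simp: dist_real_def intro!: subsetD[OF e(2)])
    then have "x + e/2 \<le> Sup X" "Inf X \<le> x - e/2"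
      using bd by (auto intro: cSup_upper cInf_lower)
    then show "x \<in> {Inf X<..<Sup X}" using e by auto
  next
    fix x assume "x \<in> {Inf X<..<Sup X}"
    then obtain y z where "y \<in> X" "x < y" "z \<in> X" "z < x"
      using X(1) by (metis cInf_lessD greaterThanLessThan_iff less_cSupE)
    then show "x \<in> X"
      using int by (meson less_imp_le mem_is_interval_1_I)
  qed
  moreover have "Inf X < Sup X"
    using calculation X(1) by (metis greaterThanLessThan_empty_iff not_le)
  ultimately show ?thesis by blast
qed

lemma open_cell_image_inner:
  fixes a :: "'a::euclidean_space"
  assumes "open_cell U"
  shows "open_cell ((\<bullet>) a ` U)"
proof -
  have lin: "linear ((\<bullet>) a)"
    by (simp add: bounded_linear.linear bounded_linear_inner_right)
  show ?thesis
    using assms convex_rel_open_linear_image[OF lin, of U]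
      bounded_linear_image[OF _ bounded_linear_inner_right, of U a]
    by (auto simp: open_cell_def)
qed

text \<open>
  A slice is relatively open in its slice of the affine hull, and the affine hull of the slice is
  that whole affine slice. So the dimension count reduces to affine subspaces.
\<close>

lemma open_cell_slice:
  assumes "open_cell U" "U \<inter> level a s \<noteq> {}"
  shows "open_cell (U \<inter> level a s)"
    and "aff_dim (U \<inter> level a s) = (if U \<subseteq> level a s then aff_dim U else aff_dim U - 1)"
proof -
  let ?A = "affine hull U \<inter> level a s"
  have U: "convex U" "rel_open U" "bounded U"
    using assms(1) by (auto simp: open_cell_def)
  have aff: "affine ?A"
    by (simp add: affine_Int affine_hyperplane)
  have op: "openin (top_of_set ?A) (U \<inter> level a s)"
    using U(2) unfolding rel_open openin_open by auto
  then have "affine hull (U \<inter> level a s) = ?A"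
    using affine_hull_openin[of ?A "U \<inter> level a s"] assms(2) affine_hull_eq[of ?A] aff
    by metis
  then have "rel_open (U \<inter> level a s)"
    using op unfolding rel_open by metis
  then show "open_cell (U \<inter> level a s)"
    using U assms(2)
    by (simp add: open_cell_def convex_Int convex_hyperplane bounded_Int)
  have "affine hull U \<subseteq> level a s \<longleftrightarrow> U \<subseteq> level a s"
    using hull_minimal[of U "level a s" affine] hull_subset[of U affine]
    by (auto simp: affine_hyperplane)
  then show "aff_dim (U \<inter> level a s) = (if U \<subseteq> level a s then aff_dim U else aff_dim U - 1)"
    using aff_dim_openin[OF op aff assms(2)] aff_dim_affine_Int_hyperplane[of "affine hull U" a s]
      assms(2) hull_subset[of U affine]
    by (auto split: if_splits)
qed

text \<open>
  This is the Euler characteristic with compact support of the slice, which explains the value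
  \<open>0\<close> on an empty slice.
\<close>

definition slice_sign :: "'a::euclidean_space \<Rightarrow> real \<Rightarrow> 'a set \<Rightarrow> int" where
  "slice_sign a s U = (if U \<inter> level a s = {} then 0 else euler_sign (U \<inter> level a s))"

lemma slice_sign_eq:
  assumes "open_cell U"
  shows "slice_sign a s U =
    (if inf_on a U = s \<and> sup_on a U = s then euler_sign U
     else if inf_on a U < s \<and> s < sup_on a U then - euler_sign U else 0)"
proof -
  let ?X = "(\<bullet>) a ` U"
  have mem: "U \<inter> level a s \<noteq> {} \<longleftrightarrow> s \<in> ?X" by auto
  have sub: "U \<subseteq> level a s \<longleftrightarrow> ?X \<subseteq> {s}" by auto
  consider "Inf ?X = Sup ?X" "?X = {Sup ?X}" | "Inf ?X < Sup ?X" "?X = {Inf ?X<..<Sup ?X}"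
    using open_cell_real[OF open_cell_image_inner[OF assms, of a]] by blast
  then show ?thesis
  proof cases
    case 1
    have "s \<in> ?X \<longleftrightarrow> s = Sup ?X" "s = Sup ?X \<longrightarrow> ?X \<subseteq> {s}"
      using 1(2) by blast+
    then show ?thesis
      using mem sub open_cell_slice(2)[OF assms, of a s] 1(1)
      by (auto simp: slice_sign_def euler_sign_def sup_on_def inf_on_def)
  next
    case 2
    have "s \<in> ?X \<longleftrightarrow> Inf ?X < s \<and> s < Sup ?X"
      using 2(2) by (metis greaterThanLessThan_iff)
    moreover have "\<not> ?X \<subseteq> {s}"
    proof
      assume *: "?X \<subseteq> {s}"
      then have "infinite {Inf ?X<..<Sup ?X}" using 2(1) by simp
      then have "infinite ?X" using 2(2) by simp
      then show False using * finite_subset by blast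
    qed
    ultimately show ?thesis
      using mem sub open_cell_slice(2)[OF assms, of a s] 2(1)
      by (auto simp: slice_sign_def euler_sign_def sup_on_def inf_on_def)
  qed
qed

definition cell_partition :: "'a::euclidean_space set set \<Rightarrow> 'a set \<Rightarrow> bool" where
  "cell_partition \<U> V \<longleftrightarrow>
     finite \<U> \<and> (\<forall>U\<in>\<U>. open_cell U) \<and> pairwise disjnt \<U> \<and> \<Union>\<U> = V"

definition slices :: "'a::euclidean_space \<Rightarrow> real \<Rightarrow> 'a set set \<Rightarrow> 'a set set" where
  "slices a s \<U> = (\<lambda>U. U \<inter> level a s) ` {U\<in>\<U>. U \<inter> level a s \<noteq> {}}"

lemma cell_partition_slices:
  assumes "cell_partition \<U> V"
  shows "cell_partition (slices a s \<U>) (V \<inter> level a s)"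
proof -
  have "disjnt (U \<inter> level a s) (W \<inter> level a s)"
    if "U \<in> \<U>" "W \<in> \<U>" "U \<inter> level a s \<noteq> W \<inter> level a s" for U W
  proof -
    have "disjnt U W"
      using assms that unfolding cell_partition_def pairwise_def by blast
    then show ?thesis unfolding disjnt_def by blast
  qed
  then have "pairwise disjnt (slices a s \<U>)"
    unfolding slices_def pairwise_def by blast
  moreover have "\<Union>(slices a s \<U>) = V \<inter> level a s"
    using assms unfolding cell_partition_def slices_def by blast
  moreover have "\<forall>W\<in>slices a s \<U>. open_cell W"
    using assms open_cell_slice(1) unfolding cell_partition_def slices_def by blast
  ultimately show ?thesis
    using assms by (simp add: cell_partition_def slices_def)
qed

lemma sum_euler_sign_slices:
  assumes "cell_partition \<U> V"
  shows "(\<Sum>W\<in>slices a s \<U>. euler_sign W) = (\<Sum>U\<in>\<U>. slice_sign a s U)"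
proof -
  have fin: "finite \<U>" and dj: "pairwise disjnt \<U>"
    using assms by (auto simp: cell_partition_def)
  have "inj_on (\<lambda>U. U \<inter> level a s) {U\<in>\<U>. U \<inter> level a s \<noteq> {}}"
  proof (rule inj_onI)
    fix U W assume "U \<in> {U\<in>\<U>. U \<inter> level a s \<noteq> {}}" "W \<in> {U\<in>\<U>. U \<inter> level a s \<noteq> {}}"
      and eq: "U \<inter> level a s = W \<inter> level a s"
    then show "U = W"
      using dj unfolding pairwise_def disjnt_def by blast
  qed
  then have "(\<Sum>W\<in>slices a s \<U>. euler_sign W) =
      (\<Sum>U\<in>{U\<in>\<U>. U \<inter> level a s \<noteq> {}}. euler_sign (U \<inter> level a s))"
    unfolding slices_def by (simp add: sum.reindex)
  also have "\<dots> = (\<Sum>U\<in>\<U>. slice_sign a s U)"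
    using fin by (simp add: slice_sign_def sum.inter_filter) (rule sum.cong; simp)
  finally show ?thesis .
qed

text \<open>
  Slice signs change only at suprema and infima, so any level \<open>s\<close> between \<open>t\<close> and the largest such
  value below \<open>t\<close> serves as the level just below \<open>t\<close>. A cell with infimum \<open>t\<close> and a larger
  supremum contributes nothing, since its slice is empty both at \<open>t\<close> and below it; a cell on which
  the form is constantly \<open>t\<close> contributes its own sign at \<open>t\<close> and nothing below, and any other cell
  with supremum \<open>t\<close> loses a slice of the opposite sign.
\<close>

lemma slice_sign_jump:
  assumes "finite \<U>" "\<And>U. U \<in> \<U> \<Longrightarrow> open_cell U"
  obtains s where "s < t"
    "\<And>U. U \<in> \<U> \<Longrightarrow>
       slice_sign a t U - slice_sign a s U = (if sup_on a U = t then euler_sign U else 0)"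
proof -
  define R where "R = {r \<in> sup_on a ` \<U> \<union> inf_on a ` \<U>. r < t}"
  have "finite (insert (t - 1) R)"
    using assms(1) by (simp add: R_def)
  moreover have "\<forall>r\<in>insert (t - 1) R. r < t" by (auto simp: R_def)
  ultimately obtain s where s: "s < t" "\<And>r. r \<in> R \<Longrightarrow> r < s"
    by (metis Max_ge Max_in dense finite.emptyI insertCI insert_not_empty le_less_trans)
  show thesis
  proof (rule that[OF s(1)])
    fix U assume U: "U \<in> \<U>"
    have "inf_on a U < t \<Longrightarrow> inf_on a U < s" "sup_on a U < t \<Longrightarrow> sup_on a U < s"
      using s(2) U by (auto simp: R_def)
    then show "slice_sign a t U - slice_sign a s U = (if sup_on a U = t then euler_sign U else 0)"
      unfolding slice_sign_eq[OF assms(2)[OF U]] using s(1)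
        open_cell_real[OF open_cell_image_inner[OF assms(2)[OF U], of a]]
      unfolding sup_on_def[symmetric] inf_on_def[symmetric] by auto
  qed
qed

text \<open>
  The sweep: subtracting the slice identities at \<open>t\<close> and just below \<open>t\<close> isolates the cells with
  supremum \<open>t\<close>. The slice identity is a hypothesis because the induction on the dimension only
  supplies it for forms that are not constant on \<open>V\<close>.
\<close>

lemma sum_sup_on_from_slices:
  assumes part: "cell_partition \<U> V" and V: "open_cell V"
    and slices: "\<And>s. (\<Sum>U\<in>\<U>. slice_sign a s U) = slice_sign a s V"
  shows "(\<Sum>U\<in>\<U>. of_int (euler_sign U) * \<phi> (sup_on a U)) =
         of_int (euler_sign V) * (\<phi> (sup_on a V) :: 'b::comm_ring_1)"
proof -
  have fin: "finite \<U>" and cells: "\<And>U. U \<in> \<U> \<Longrightarrow> open_cell U"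
    using part by (auto simp: cell_partition_def)
  have step: "(\<Sum>U | U \<in> \<U> \<and> sup_on a U = t. euler_sign U) =
              (if t = sup_on a V then euler_sign V else 0)" for t
  proof -
    obtain s where s: "\<And>U. U \<in> insert V \<U> \<Longrightarrow>
        slice_sign a t U - slice_sign a s U = (if sup_on a U = t then euler_sign U else 0)"
      by (rule slice_sign_jump[of "insert V \<U>" t a]) (use fin cells V in auto)
    have "(\<Sum>U | U \<in> \<U> \<and> sup_on a U = t. euler_sign U) =
          (\<Sum>U\<in>\<U>. if sup_on a U = t then euler_sign U else 0)"
      using fin by (simp add: sum.inter_filter)
    also have "\<dots> = (\<Sum>U\<in>\<U>. slice_sign a t U - slice_sign a s U)"
      using s by (intro sum.cong) auto
    also have "\<dots> = slice_sign a t V - slice_sign a s V"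
      by (simp add: sum_subtractf slices)
    finally show ?thesis using s[of V] by auto
  qed
  \<comment> \<open>Inserting the supremum on \<open>V\<close> saves showing that some cell attains it.\<close>
  define R where "R = insert (sup_on a V) (sup_on a ` \<U>)"
  have "(\<Sum>U\<in>\<U>. of_int (euler_sign U) * \<phi> (sup_on a U)) =
        (\<Sum>t\<in>R. \<Sum>U | U \<in> \<U> \<and> sup_on a U = t. of_int (euler_sign U) * \<phi> (sup_on a U))"
    using fin by (intro sum.group[symmetric]) (auto simp: R_def)
  also have "\<dots> = (\<Sum>t\<in>R. of_int (\<Sum>U | U \<in> \<U> \<and> sup_on a U = t. euler_sign U) * \<phi> t)"
    by (intro sum.cong) (auto simp: sum_distrib_right)
  also have "\<dots> = (\<Sum>t\<in>R. if t = sup_on a V then of_int (euler_sign V) * \<phi> t else 0)"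
    unfolding step by (intro sum.cong) auto
  also have "\<dots> = of_int (euler_sign V) * \<phi> (sup_on a V)"
    using fin by (simp add: R_def)
  finally show ?thesis .
qed

text \<open>
  A form that is not constant on \<open>V\<close> lowers the dimension of every slice, so the induction
  hypothesis yields the slice identities, and the sweep with constant weight \<open>1\<close> gives the total.
\<close>

lemma sum_euler_sign_cell_partition:
  assumes "cell_partition \<U> V" "open_cell V"
  shows "(\<Sum>U\<in>\<U>. euler_sign U) = euler_sign V"
  using assms
proof (induction "nat (aff_dim V)" arbitrary: \<U> V rule: less_induct)
  case less
  show ?case
  proof (cases "\<exists>v. V = {v}")
    case True
    then obtain v where v: "V = {v}" ..
    have "U = {v}" if "U \<in> \<U>" for U
    proof -
      have "U \<subseteq> {v}" "U \<noteq> {}"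
        using that less.prems(1) v by (auto simp: cell_partition_def open_cell_def)
      then show ?thesis by blast
    qed
    moreover have "\<U> \<noteq> {}"
      using less.prems v by (auto simp: cell_partition_def)
    ultimately have "\<U> = {{v}}" by blast
    then show ?thesis using v by simp
  next
    case False
    then obtain x y where xy: "x \<in> V" "y \<in> V" "x \<noteq> y"
      using less.prems(2) unfolding open_cell_def by blast
    \<comment> \<open>This form separates \<open>x\<close> from \<open>y\<close>, as the difference of its values is \<open>|x - y|\<^sup>2 > 0\<close>.\<close>
    define a where "a = x - y"
    have "a \<bullet> x \<noteq> a \<bullet> y"
      using xy(3) unfolding a_def by (metis eq_iff_diff_eq_0 inner_diff_right inner_eq_zero_iff)
    then have nonconst: "\<not> V \<subseteq> level a s" for s
      using xy by auto
    have "aff_dim V > 0"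
      using False less.prems(2) aff_dim_geq[of V] aff_dim_eq_0[of V]
      by (metis aff_dim_empty aff_dim_negative_iff linorder_neqE_linordered_idom open_cell_def)
    have "(\<Sum>U\<in>\<U>. slice_sign a s U) = slice_sign a s V" for s
    proof (cases "V \<inter> level a s = {}")
      case True
      then have "U \<inter> level a s = {}" if "U \<in> \<U>" for U
        using that less.prems(1) unfolding cell_partition_def by blast
      then show ?thesis using True by (simp add: slice_sign_def)
    next
      case ne: False
      have "aff_dim (V \<inter> level a s) = aff_dim V - 1"
        using open_cell_slice(2)[OF less.prems(2) ne] nonconst by simp
      then have "nat (aff_dim (V \<inter> level a s)) < nat (aff_dim V)"
        using \<open>aff_dim V > 0\<close> by simp
      then have "(\<Sum>W\<in>slices a s \<U>. euler_sign W) = euler_sign (V \<inter> level a s)"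
        using less.hyps cell_partition_slices[OF less.prems(1)] open_cell_slice(1)[OF less.prems(2) ne]
        by blast
      then show ?thesis
        using sum_euler_sign_slices[OF less.prems(1)] ne by (simp add: slice_sign_def)
    qed
    from sum_sup_on_from_slices[OF less.prems this, where \<phi> = "\<lambda>_. 1::int"]
    show ?thesis by simp
  qed
qed

text \<open>
  With the total sign known in every dimension, the slice identity holds for every form, even
  for one that is constant on \<open>V\<close> and has all of \<open>V\<close> as a slice.
\<close>

proposition sum_sup_on_cell_partition:
  assumes part: "cell_partition \<U> V" and V: "open_cell V"
  shows "(\<Sum>U\<in>\<U>. of_int (euler_sign U) * \<phi> (sup_on a U)) =
         of_int (euler_sign V) * (\<phi> (sup_on a V) :: 'b::comm_ring_1)"
proof (rule sum_sup_on_from_slices[OF part V])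
  fix s
  show "(\<Sum>U\<in>\<U>. slice_sign a s U) = slice_sign a s V"
  proof (cases "V \<inter> level a s = {}")
    case True
    then have "U \<inter> level a s = {}" if "U \<in> \<U>" for U
      using that part unfolding cell_partition_def by blast
    then show ?thesis using True by (simp add: slice_sign_def)
  next
    case False
    then show ?thesis
      using sum_euler_sign_cell_partition[OF cell_partition_slices[OF part] open_cell_slice(1)[OF V]]
        sum_euler_sign_slices[OF part] by (simp add: slice_sign_def)
  qed
qed


section \<open>Internal faces of polytopal subdivisions\<close>

lemma open_cell_rel_interior:
  assumes "polytope C" "C \<noteq> {}"
  shows "open_cell (rel_interior C)"
proof -
  have C: "convex C" "bounded C"
    using assms(1) by (simp_all add: polytope_imp_convex polytope_imp_bounded)
  then have "bounded (rel_interior C)"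
    using bounded_subset rel_interior_subset by blast
  with C assms(2) show ?thesis
    unfolding open_cell_def
    by (intro conjI) (simp_all add: convex_rel_interior rel_interior_rel_open rel_interior_eq_empty)
qed

lemma euler_sign_rel_interior:
  "convex C \<Longrightarrow> euler_sign (rel_interior C) = euler_sign C"
  by (simp add: euler_sign_def rel_interior_aff_dim)

text \<open>
  The relative boundary of a polytope is the union of its proper faces, and a face that contains
  a relative interior point of \<open>C\<close> contains \<open>C\<close>. Hence the relative interior of a cell lies either
  in the relative interior or in the relative boundary of the whole.
\<close>

lemma rel_interior_subset_rel_interior:
  fixes P :: "'a::euclidean_space set"
  assumes P: "polytope P" and "C \<subseteq> P" "\<not> C \<subseteq> rel_frontier P"
  shows "rel_interior C \<subseteq> rel_interior P"
proof
  fix y assume y: "y \<in> rel_interior C"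
  have pf: "rel_frontier P = \<Union> {F. F face_of P \<and> F \<noteq> P}"
    using P by (simp add: rel_frontier_of_polyhedron_alt polytope_imp_polyhedron)
  show "y \<in> rel_interior P"
  proof (rule ccontr)
    assume "y \<notin> rel_interior P"
    moreover have "y \<in> P" using y assms(2) rel_interior_subset by blast
    ultimately have "y \<in> rel_frontier P"
      by (simp add: rel_frontier_def P closure_closed polytope_imp_closed)
    then obtain F where F: "F face_of P" "F \<noteq> P" "y \<in> F"
      using pf by auto
    then have "C \<subseteq> F"
      using subset_of_face_of[of F P C] assms(2) y by blast
    then show False
      using F pf assms(3) by blast
  qed
qed

text \<open>
  A cell of least dimension among those containing \<open>x\<close> has \<open>x\<close> in its relative interior, for
  otherwise a proper face of it would be a smaller cell containing \<open>x\<close>.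
\<close>

lemma exists_rel_interior_cell:
  fixes x :: "'a::euclidean_space"
  assumes D: "polytopal_subdivision \<D> P" and "x \<in> P"
  obtains C where "C \<in> \<D>" "x \<in> rel_interior C"
proof -
  have D': "\<Union>\<D> = P" "\<And>C. C \<in> \<D> \<Longrightarrow> polytope C"
    "\<And>C F. C \<in> \<D> \<Longrightarrow> F face_of C \<Longrightarrow> F \<noteq> {} \<Longrightarrow> F \<in> \<D>"
    using D unfolding polytopal_subdivision_def by blast+
  obtain C0 where "C0 \<in> \<D> \<and> x \<in> C0" using D'(1) assms(2) by blast
  then obtain C where C: "C \<in> \<D>" "x \<in> C"
    and min: "\<And>C'. C' \<in> \<D> \<Longrightarrow> x \<in> C' \<Longrightarrow> nat (aff_dim C) \<le> nat (aff_dim C')"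
    using ex_has_least_nat[of "\<lambda>C. C \<in> \<D> \<and> x \<in> C" C0 "\<lambda>C. nat (aff_dim C)"] by blast
  have "x \<in> rel_interior C"
  proof (rule ccontr)
    assume "x \<notin> rel_interior C"
    then have "x \<in> rel_frontier C"
      using C D'(2) by (simp add: rel_frontier_def closure_closed polytope_imp_closed)
    then obtain F where F: "F face_of C" "F \<noteq> C" "x \<in> F"
      using C D'(2) by (auto simp: rel_frontier_of_polyhedron_alt polytope_imp_polyhedron)
    have "aff_dim F < aff_dim C"
      using F face_of_aff_dim_lt[of C F] C D'(2) polytope_imp_convex by blast
    moreover have "aff_dim F \<ge> 0"
      using F(3) by (metis aff_dim_negative_iff empty_iff not_le)
    ultimately show False
      using min[of F] D'(3)[OF C(1) F(1)] F(3) by force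
  qed
  with C(1) that show thesis by blast
qed

lemma cell_partition_internal_faces:
  fixes P :: "'a::euclidean_space set"
  assumes D: "polytopal_subdivision \<D> P" and P: "polytope P"
  shows "cell_partition (rel_interior ` internal_faces \<D> P) (rel_interior P)"
    and "inj_on rel_interior (internal_faces \<D> P)"
proof -
  have D': "finite \<D>" "\<Union>\<D> = P" "\<And>C. C \<in> \<D> \<Longrightarrow> polytope C" "\<And>C. C \<in> \<D> \<Longrightarrow> C \<noteq> {}"
    "\<And>C C'. C \<in> \<D> \<Longrightarrow> C' \<in> \<D> \<Longrightarrow> C \<inter> C' face_of C \<and> C \<inter> C' face_of C'"
    using D unfolding polytopal_subdivision_def by blast+
  have ne: "rel_interior C \<noteq> {}" if "C \<in> \<D>" for C
    using that D'(3,4) by (simp add: rel_interior_eq_empty polytope_imp_convex)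
  have same: "C = C'" if C: "C \<in> \<D>" "C' \<in> \<D>" and x: "x \<in> rel_interior C" "x \<in> rel_interior C'" for C C' x
  proof -
    have "x \<in> C \<inter> C'" using x rel_interior_subset by blast
    then have "C \<inter> C' = C" "C \<inter> C' = C'"
      using face_of_disjoint_rel_interior[of "C \<inter> C'"] D'(5)[OF C] x by blast+
    then show ?thesis by simp
  qed
  show inj: "inj_on rel_interior (internal_faces \<D> P)"
  proof (rule inj_onI)
    fix C C' assume *: "C \<in> internal_faces \<D> P" "C' \<in> internal_faces \<D> P"
      "rel_interior C = rel_interior C'"
    then have "C \<in> \<D>" "C' \<in> \<D>" by (auto simp: internal_faces_def)
    moreover from this obtain x where "x \<in> rel_interior C" using ne by blast
    ultimately show "C = C'" using same *(3) by blast
  qed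
  have "pairwise disjnt (rel_interior ` internal_faces \<D> P)"
    unfolding pairwise_def disjnt_def using same by (auto simp: internal_faces_def)
  moreover have "\<Union> (rel_interior ` internal_faces \<D> P) = rel_interior P"
  proof
    have "rel_interior C \<subseteq> rel_interior P" if "C \<in> internal_faces \<D> P" for C
      using rel_interior_subset_rel_interior[OF P, of C] D'(2) that
      unfolding internal_faces_def by blast
    then show "\<Union> (rel_interior ` internal_faces \<D> P) \<subseteq> rel_interior P"
      by blast
    show "rel_interior P \<subseteq> \<Union> (rel_interior ` internal_faces \<D> P)"
    proof
      fix x assume x: "x \<in> rel_interior P"
      then obtain C where C: "C \<in> \<D>" "x \<in> rel_interior C"
        using exists_rel_interior_cell[OF D] rel_interior_subset by blast
      moreover have "\<not> C \<subseteq> rel_frontier P"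
        using C(2) x rel_interior_subset unfolding rel_frontier_def by blast
      ultimately show "x \<in> \<Union> (rel_interior ` internal_faces \<D> P)"
        by (auto simp: internal_faces_def)
    qed
  qed
  moreover have "open_cell (rel_interior C)" if "C \<in> internal_faces \<D> P" for C
    using that D'(3,4) unfolding internal_faces_def by (blast intro: open_cell_rel_interior)
  moreover have "finite (internal_faces \<D> P)"
    using D'(1) by (simp add: internal_faces_def)
  ultimately show "cell_partition (rel_interior ` internal_faces \<D> P) (rel_interior P)"
    by (simp add: cell_partition_def)
qed

text \<open>
  A function of the maximum of a linear form satisfies the valuative identity for every
  polytopal subdivision. Multiplying both sides by the sign of \<open>P\<close> gives the signs
  \<open>(-1) ^ (dim P - dim C)\<close>.
\<close>

proposition sum_sup_on_internal_faces:
  fixes P :: "'a::euclidean_space set" and \<phi> :: "real \<Rightarrow> 'b::comm_ring_1"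
  assumes D: "polytopal_subdivision \<D> P" and P: "polytope P" "P \<noteq> {}"
  shows "(\<Sum>C\<in>internal_faces \<D> P. of_int (euler_sign C) * \<phi> (sup_on a (rel_interior C))) =
         of_int (euler_sign P) * \<phi> (sup_on a (rel_interior P))"
proof -
  have conv: "convex C" if "C \<in> internal_faces \<D> P" for C
    using that D unfolding internal_faces_def polytopal_subdivision_def
    by (blast intro: polytope_imp_convex)
  have "(\<Sum>C\<in>internal_faces \<D> P. of_int (euler_sign C) * \<phi> (sup_on a (rel_interior C))) =
        (\<Sum>C\<in>internal_faces \<D> P.
           of_int (euler_sign (rel_interior C)) * \<phi> (sup_on a (rel_interior C)))"
    by (rule sum.cong) (simp_all add: euler_sign_rel_interior conv)
  also have "\<dots> = (\<Sum>U\<in>rel_interior ` internal_faces \<D> P. of_int (euler_sign U) * \<phi> (sup_on a U))"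
    by (simp add: sum.reindex[OF cell_partition_internal_faces(2)[OF D P(1)]])
  also have "\<dots> = of_int (euler_sign (rel_interior P)) * \<phi> (sup_on a (rel_interior P))"
    by (rule sum_sup_on_cell_partition[OF cell_partition_internal_faces(1)[OF D P(1)]
          open_cell_rel_interior[OF P]])
  finally show ?thesis
    by (simp add: euler_sign_rel_interior polytope_imp_convex P(1))
qed

text \<open>
  Both sides are least upper bounds of the form, because a closed halfspace contains the relative
  interior of a convex hull exactly if it contains its generators.
\<close>

lemma sup_on_rel_interior_convex_hull:
  fixes X :: "'a::euclidean_space set"
  assumes "X \<noteq> {}" "finite X"
  shows "sup_on a (rel_interior (convex hull X)) = Max ((\<bullet>) a ` X)"
proof -
  let ?C = "convex hull X"
  have le_iff: "(\<forall>x\<in>rel_interior ?C. a \<bullet> x \<le> s) \<longleftrightarrow> (\<forall>x\<in>X. a \<bullet> x \<le> s)" for s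
  proof
    assume "\<forall>x\<in>rel_interior ?C. a \<bullet> x \<le> s"
    then have "closure (rel_interior ?C) \<subseteq> {x. a \<bullet> x \<le> s}"
      by (intro closure_minimal closed_halfspace_le) auto
    then have "?C \<subseteq> {x. a \<bullet> x \<le> s}"
      using convex_closure_rel_interior[of ?C] closure_subset[of ?C] by auto
    then show "\<forall>x\<in>X. a \<bullet> x \<le> s"
      using hull_subset[of X convex] by blast
  next
    assume "\<forall>x\<in>X. a \<bullet> x \<le> s"
    then have "?C \<subseteq> {x. a \<bullet> x \<le> s}"
      by (intro hull_minimal convex_halfspace_le) auto
    then show "\<forall>x\<in>rel_interior ?C. a \<bullet> x \<le> s"
      using rel_interior_subset by blast
  qed
  have ne: "rel_interior ?C \<noteq> {}"
    using assms(1) by (simp add: rel_interior_eq_empty)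
  have Max_le: "Max ((\<bullet>) a ` X) \<le> s \<longleftrightarrow> (\<forall>x\<in>X. a \<bullet> x \<le> s)" for s
    using assms by simp
  show ?thesis
    unfolding sup_on_def
  proof (rule cSup_eq_non_empty)
    show "(\<bullet>) a ` rel_interior ?C \<noteq> {}" using ne by blast
    show "y \<le> Max ((\<bullet>) a ` X)" if "y \<in> (\<bullet>) a ` rel_interior ?C" for y
      using that le_iff Max_le by blast
    show "Max ((\<bullet>) a ` X) \<le> s" if "\<And>y. y \<in> (\<bullet>) a ` rel_interior ?C \<Longrightarrow> y \<le> s" for s
    proof -
      have "\<forall>x\<in>rel_interior ?C. a \<bullet> x \<le> s" by (intro ballI that imageI)
      then show ?thesis unfolding le_iff Max_le .
    qed
  qed
qed


section \<open>Ranks of matroids and expected codimension\<close>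

text \<open>
  Exchanging an element of \<open>A - B\<close> for one of \<open>B - A\<close> keeps the size of \<open>A\<close> and brings it closer to
  \<open>B\<close>; once \<open>A \<subseteq> B\<close>, an element of \<open>B - A\<close> would have nothing to be exchanged for.
\<close>

lemma bases_card_eq:
  assumes "matroid_on E \<B>" "A \<in> \<B>" "B \<in> \<B>"
  shows "card A = card B"
  using assms(2)
proof (induction "card (A - B)" arbitrary: A rule: less_induct)
  case less
  have fin: "finite A" "finite B"
    using assms less.prems unfolding matroid_on_def by (meson finite_subset)+
  show ?case
  proof (cases "A \<subseteq> B")
    case True
    have "B - A = {}"
    proof (rule ccontr)
      assume "B - A \<noteq> {}"
      then obtain x where "x \<in> B - A" by blast
      then obtain y where "y \<in> A - B"
        using assms(1,3) less.prems unfolding matroid_on_def by blast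
      then show False using True by blast
    qed
    then show ?thesis using True by (simp add: subset_antisym)
  next
    case False
    then obtain x where x: "x \<in> A - B" by blast
    then obtain y where y: "y \<in> B - A" "insert y (A - {x}) \<in> \<B>"
      using assms(1,3) less.prems unfolding matroid_on_def by blast
    have "insert y (A - {x}) - B = (A - B) - {x}" using x y by blast
    then have "card (insert y (A - {x}) - B) < card (A - B)"
      using x fin by (metis card_Diff1_less finite_Diff)
    moreover have "card (insert y (A - {x})) = card A"
    proof -
      have "card (insert y (A - {x})) = Suc (card (A - {x}))"
        using y(1) fin(1) by (intro card_insert_disjoint) auto
      also have "\<dots> = card A"
        using x fin(1) by (intro card_Suc_Diff1) auto
      finally show ?thesis .
    qed
    ultimately show ?thesis using less.hyps y(2) by metis
  qed
qed

lemma matroid_rank_eq_Max: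
  fixes \<B> :: "'n::finite set set"
  assumes ne: "\<B> \<noteq> {}"
  shows "matroid_rank \<B> S = Max ((\<lambda>B. card (B \<inter> S)) ` \<B>)"
proof -
  let ?I = "{I. I \<subseteq> S \<and> indep_in \<B> I}"
  have "Max (card ` ?I) \<le> Max ((\<lambda>B. card (B \<inter> S)) ` \<B>)"
  proof (rule Max.boundedI)
    show "card ` ?I \<noteq> {}" using ne by (auto simp: indep_in_def)
    fix m assume "m \<in> card ` ?I"
    then obtain I B where "I \<subseteq> B \<inter> S" "B \<in> \<B>" "m = card I"
      by (auto simp: indep_in_def)
    then have "m \<le> card (B \<inter> S)" by (simp add: card_mono)
    also have "\<dots> \<le> Max ((\<lambda>B. card (B \<inter> S)) ` \<B>)"
      using \<open>B \<in> \<B>\<close> by simp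
    finally show "m \<le> Max ((\<lambda>B. card (B \<inter> S)) ` \<B>)" .
  qed simp
  moreover have "Max ((\<lambda>B. card (B \<inter> S)) ` \<B>) \<le> Max (card ` ?I)"
    using ne by (intro Max_mono) (auto simp: indep_in_def)
  ultimately show ?thesis
    unfolding matroid_rank_def by simp
qed

lemma card_Int_le_matroid_rank:
  fixes E :: "'n::finite set"
  assumes "matroid_on E \<B>" "B \<in> \<B>"
  shows "card (B \<inter> S) \<le> matroid_rank \<B> S"
proof -
  have "card (B \<inter> S) \<le> Max ((\<lambda>B. card (B \<inter> S)) ` \<B>)"
    using assms(2) by (intro Max_ge) auto
  also have "\<dots> = matroid_rank \<B> S"
    using assms(2) by (intro matroid_rank_eq_Max[symmetric]) auto
  finally show ?thesis .
qed

lemma matroid_rank_attained: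
  fixes E :: "'n::finite set"
  assumes "matroid_on E \<B>"
  obtains B where "B \<in> \<B>" "card (B \<inter> S) = matroid_rank \<B> S"
proof -
  have "Max ((\<lambda>B. card (B \<inter> S)) ` \<B>) \<in> (\<lambda>B. card (B \<inter> S)) ` \<B>"
    using assms by (intro Max_in) (auto simp: matroid_on_def)
  then show thesis
    using that matroid_rank_eq_Max[of \<B> S] assms
    by (metis (no_types, lifting) imageE matroid_on_def)
qed

lemma matroid_rank_le_card:
  fixes E :: "'n::finite set"
  assumes "matroid_on E \<B>"
  shows "matroid_rank \<B> S \<le> card S"
proof -
  obtain B where "card (B \<inter> S) = matroid_rank \<B> S"
    using matroid_rank_attained[OF assms] .
  moreover have "card (B \<inter> S) \<le> card S" by (simp add: card_mono)
  ultimately show ?thesis by simp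
qed

lemma matroid_rank_ground:
  fixes E :: "'n::finite set"
  assumes "matroid_on E \<B>" "B \<in> \<B>"
  shows "matroid_rank \<B> E = card B"
proof -
  obtain A where "A \<in> \<B>" "card (A \<inter> E) = matroid_rank \<B> E"
    using matroid_rank_attained[OF assms(1)] .
  moreover have "A \<inter> E = A" using assms(1) \<open>A \<in> \<B>\<close> by (auto simp: matroid_on_def)
  ultimately show ?thesis using bases_card_eq[OF assms(1) _ assms(2)] by simp
qed

text \<open>
  The greedy principle for a chain. Among the bases that are optimal for \<open>T\<close>, take \<open>B\<close> as close as
  possible to a basis \<open>A\<close> that is optimal for \<open>S\<close>. If \<open>B\<close> met \<open>S\<close> in fewer elements than \<open>A\<close>, it
  would have, being of the same size, an element outside \<open>S\<close> and \<open>A\<close>; exchanging it for an element of \<open>A\<close> does not harm the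
  intersection with \<open>T\<close> and moves \<open>B\<close> closer to \<open>A\<close>.
\<close>

lemma matroid_rank_chain_attained:
  fixes E :: "'n::finite set"
  assumes M: "matroid_on E \<B>" and "T \<subseteq> S"
  obtains B where "B \<in> \<B>" "card (B \<inter> T) = matroid_rank \<B> T" "card (B \<inter> S) = matroid_rank \<B> S"
proof -
  obtain A where A: "A \<in> \<B>" "card (A \<inter> S) = matroid_rank \<B> S"
    using matroid_rank_attained[OF M] .
  obtain B0 where "B0 \<in> \<B> \<and> card (B0 \<inter> T) = matroid_rank \<B> T"
    using matroid_rank_attained[OF M] by metis
  then obtain B where B: "B \<in> \<B>" "card (B \<inter> T) = matroid_rank \<B> T"
    and min: "\<And>B'. B' \<in> \<B> \<Longrightarrow> card (B' \<inter> T) = matroid_rank \<B> T \<Longrightarrow> card (B - A) \<le> card (B' - A)"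
    using ex_has_least_nat[of "\<lambda>B. B \<in> \<B> \<and> card (B \<inter> T) = matroid_rank \<B> T" B0 "\<lambda>B. card (B - A)"]
    by blast
  have "card (A \<inter> S) \<le> card (B \<inter> S)"
  proof (rule ccontr)
    assume *: "\<not> card (A \<inter> S) \<le> card (B \<inter> S)"
    have "card A = card B" using bases_card_eq[OF M A(1) B(1)] .
    then have "card (A - S) < card (B - S)"
      using * card_Int_Diff[of A S] card_Int_Diff[of B S] by simp
    then have "\<not> B - S \<subseteq> A - S"
      by (meson card_mono finite not_le)
    then obtain x where x: "x \<in> B - A" "x \<notin> S" by blast
    then obtain y where y: "y \<in> A - B" "insert y (B - {x}) \<in> \<B>"
      using M A(1) B(1) unfolding matroid_on_def by blast
    let ?B = "insert y (B - {x})"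
    have "B \<inter> T \<subseteq> ?B \<inter> T" using x(2) assms(2) by blast
    then have "card (B \<inter> T) \<le> card (?B \<inter> T)" by (simp add: card_mono)
    then have "card (?B \<inter> T) = matroid_rank \<B> T"
      using B(2) card_Int_le_matroid_rank[OF M y(2), of T] by simp
    moreover have "?B - A = (B - A) - {x}" using y by blast
    then have "card (?B - A) < card (B - A)"
      using x by (metis card_Diff1_less finite)
    ultimately show False using min y(2) by fastforce
  qed
  then have "card (B \<inter> S) = matroid_rank \<B> S"
    using A(2) card_Int_le_matroid_rank[OF M B(1), of S] by simp
  with B that show thesis by blast
qed


lemma a_coeff_Moebius:
  "a_coeff \<B> S = (\<Sum>T\<in>Pow S. (-1) ^ (card S - card T) * nullity \<B> T)"
proof (rule inclusion_exclusion_mobius[where f = "a_coeff \<B>" and g = "nullity \<B>"])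
  fix S :: "'a set"
  have Pow: "Pow S = insert S {T. T \<subset> S}" by auto
  have "a_coeff \<B> S = nullity \<B> S - (\<Sum>T | T \<subset> S. a_coeff \<B> T)"
    by (rule a_coeff.simps)
  then show "nullity \<B> S = (\<Sum>T\<in>Pow S. a_coeff \<B> T)"
    unfolding Pow by simp
qed simp

text \<open>
  Moebius inversion removes the recursion. Besides the rank of \<open>E\<close>, each summand depends on the
  matroid only through the ranks of the two members of a chain \<open>T \<subseteq> S\<close>.
\<close>

lemma ec_eq_sum_chains:
  "ec E \<B> = (\<Sum>S\<in>Pow E. \<Sum>T\<in>Pow S. (-1) ^ (card S - card T) *
     ((int (matroid_rank \<B> E) - int (matroid_rank \<B> S)) * nullity \<B> T))"
  unfolding ec_def a_coeff_Moebius sum_distrib_left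
  by (rule sum.cong[OF refl], rule sum.cong[OF refl], rule mult.left_commute)

lemma matroid_rank_image:
  fixes \<phi> :: "'n::finite \<Rightarrow> 'm::finite"
  assumes M: "matroid_on E \<B>" and inj: "inj_on \<phi> E" and "S \<subseteq> E"
  shows "matroid_rank ((`) \<phi> ` \<B>) (\<phi> ` S) = matroid_rank \<B> S"
proof -
  have ne: "\<B> \<noteq> {}" using M by (simp add: matroid_on_def)
  have "card (\<phi> ` B \<inter> \<phi> ` S) = card (B \<inter> S)" if "B \<in> \<B>" for B
  proof -
    have "B \<subseteq> E" using M that by (simp add: matroid_on_def)
    then have "\<phi> ` B \<inter> \<phi> ` S = \<phi> ` (B \<inter> S)"
      using inj_on_image_Int[OF inj] assms(3) by simp
    moreover have "inj_on \<phi> (B \<inter> S)"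
      using inj \<open>B \<subseteq> E\<close> by (meson inf.coboundedI1 inj_on_subset)
    ultimately show ?thesis by (simp add: card_image)
  qed
  then have "(\<lambda>B. card (B \<inter> \<phi> ` S)) ` ((`) \<phi> ` \<B>) = (\<lambda>B. card (B \<inter> S)) ` \<B>"
    by (simp add: image_image cong: image_cong)
  then show ?thesis
    using ne by (simp add: matroid_rank_eq_Max)
qed

lemma matroid_invariant_ec: "matroid_invariant (ec :: 'n::finite set \<Rightarrow> 'n set set \<Rightarrow> int)"
  unfolding matroid_invariant_def
proof (intro allI impI)
  fix E E' :: "'n set" and \<phi> \<B>
  assume *: "matroid_on E \<B> \<and> bij_betw \<phi> E E'"
  then have M: "matroid_on E \<B>" and inj: "inj_on \<phi> E" and E': "E' = \<phi> ` E"
    by (auto simp: bij_betw_def)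
  let ?\<B> = "(`) \<phi> ` \<B>"
  have inj': "inj_on \<phi> S" if "S \<subseteq> E" for S
    using inj that by (rule inj_on_subset)
  have sum_Pow: "(\<Sum>T\<in>Pow (\<phi> ` S). f T) = (\<Sum>T\<in>Pow S. f (\<phi> ` T))" if "S \<subseteq> E"
    for S and f :: "'n set \<Rightarrow> int"
  proof -
    have "Pow (\<phi> ` S) = (`) \<phi> ` Pow S" by (simp add: image_Pow_surj)
    moreover have "inj_on ((`) \<phi>) (Pow S)" using inj'[OF that] by (rule inj_on_image_Pow)
    ultimately show ?thesis by (simp add: sum.reindex)
  qed
  have card: "card (\<phi> ` S) = card S" if "S \<subseteq> E" for S
    using inj'[OF that] by (rule card_image)
  have rank: "matroid_rank ?\<B> (\<phi> ` S) = matroid_rank \<B> S" if "S \<subseteq> E" for S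
    using matroid_rank_image[OF M inj that] .
  show "ec E' ?\<B> = ec E \<B>"
    unfolding ec_eq_sum_chains E' sum_Pow[OF subset_refl]
  proof (rule sum.cong[OF refl])
    fix S assume "S \<in> Pow E"
    then have S: "S \<subseteq> E" by simp
    then have "T \<subseteq> E" if "T \<in> Pow S" for T using that by blast
    then show "(\<Sum>T\<in>Pow (\<phi> ` S). (- 1) ^ (card (\<phi> ` S) - card T) *
          ((int (matroid_rank ?\<B> (\<phi> ` E)) - int (matroid_rank ?\<B> (\<phi> ` S))) * nullity ?\<B> T)) =
        (\<Sum>T\<in>Pow S. (- 1) ^ (card S - card T) *
          ((int (matroid_rank \<B> E) - int (matroid_rank \<B> S)) * nullity \<B> T))"
      unfolding sum_Pow[OF S] using S
      by (intro sum.cong refl) (simp add: rank card nullity_def)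
  qed
qed

section \<open>Matroid polytopes and valuativity\<close>

text \<open>
  A vertex of the cube is not a convex combination of other vertices: the linear form with
  coefficients \<open>1\<close> on \<open>B\<close> and \<open>-1\<close> off \<open>B\<close> takes the value \<open>|B|\<close> there and at most \<open>|B| - 1\<close> at
  every other vertex. So a matroid is determined by its polytope, and the cells of a subdivision
  of \<open>P(M)\<close> only have bases of \<open>M\<close>.
\<close>

lemma indicator_vec_in_matroid_polytope:
  fixes B :: "'n::finite set"
  shows "indicator_vec B \<in> matroid_polytope \<N> \<longleftrightarrow> B \<in> \<N>"
proof
  assume "B \<in> \<N>"
  then show "indicator_vec B \<in> matroid_polytope \<N>"
    unfolding matroid_polytope_def by (simp add: hull_inc)
next
  assume in_hull: "indicator_vec B \<in> matroid_polytope \<N>"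
  define u :: "real ^ 'n" where "u = (\<chi> i. if i \<in> B then 1 else - 1)"
  have u: "u \<bullet> indicator_vec A = real (card (A \<inter> B)) - real (card (A - B))" for A
  proof -
    have "u \<bullet> indicator_vec A = (\<Sum>i\<in>A. if i \<in> B then 1 else - 1)"
      by (simp add: u_def indicator_vec_def inner_vec_def if_distrib[of "(*) _"] sum.If_cases
          cong: if_cong)
    also have "\<dots> = real (card (A \<inter> B)) - real (card (A - B))"
      by (simp add: sum.If_cases Diff_eq)
    finally show ?thesis .
  qed
  show "B \<in> \<N>"
  proof (rule ccontr)
    assume "B \<notin> \<N>"
    have "u \<bullet> indicator_vec A \<le> real (card B) - 1" if "A \<in> \<N>" for A
    proof (cases "B \<subseteq> A")
      case True
      then have "A - B \<noteq> {}"
        using \<open>B \<notin> \<N>\<close> that by (metis Diff_eq_empty_iff subset_antisym)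
      then have "card (A - B) \<ge> 1" by (simp add: Suc_leI card_gt_0_iff)
      moreover have "A \<inter> B = B" using True by blast
      ultimately show ?thesis by (simp add: u)
    next
      case False
      then have "card (A \<inter> B) < card B" by (intro psubset_card_mono) auto
      then show ?thesis by (simp add: u)
    qed
    then have "matroid_polytope \<N> \<subseteq> {x. u \<bullet> x \<le> real (card B) - 1}"
      unfolding matroid_polytope_def by (intro hull_minimal convex_halfspace_le) auto
    with in_hull have "u \<bullet> indicator_vec B \<le> real (card B) - 1" by blast
    then show False by (simp add: u)
  qed
qed

lemma matroid_polytope_subset_iff:
  "matroid_polytope \<N> \<subseteq> matroid_polytope \<M> \<longleftrightarrow> \<N> \<subseteq> \<M>"
proof
  assume "matroid_polytope \<N> \<subseteq> matroid_polytope \<M>"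
  then show "\<N> \<subseteq> \<M>"
    using indicator_vec_in_matroid_polytope by (meson subsetD subsetI)
next
  assume "\<N> \<subseteq> \<M>"
  then show "matroid_polytope \<N> \<subseteq> matroid_polytope \<M>"
    unfolding matroid_polytope_def by (intro hull_mono image_mono)
qed

lemma polytope_matroid_polytope: "polytope (matroid_polytope \<N>)"
  unfolding matroid_polytope_def by (intro polytope_convex_hull finite_imageI finite)


text \<open>
  The factor \<open>CARD('n) + 1\<close> exceeds every cardinality and hence every rank, so that the maximum
  of this form encodes two ranks in one number.
\<close>

definition flag_weight :: "'n::finite set \<Rightarrow> 'n set \<Rightarrow> real ^ 'n" where
  "flag_weight T S = (real CARD('n) + 1) *\<^sub>R indicator_vec T + indicator_vec S"

lemma inner_indicator_vec: "indicator_vec A \<bullet> indicator_vec B = real (card (A \<inter> B))"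
proof -
  have "indicator_vec A \<bullet> indicator_vec B = (\<Sum>i\<in>UNIV. if i \<in> A \<inter> B then 1 else 0 :: real)"
    unfolding inner_vec_def indicator_vec_def by (intro sum.cong) auto
  also have "\<dots> = real (card (A \<inter> B))" by (simp add: sum.If_cases Int_def)
  finally show ?thesis .
qed

lemma inner_flag_weight:
  fixes B :: "'n::finite set"
  shows "flag_weight T S \<bullet> indicator_vec B =
    real ((CARD('n) + 1) * card (B \<inter> T) + card (B \<inter> S))"
  by (simp add: flag_weight_def inner_add_left inner_indicator_vec Int_commute algebra_simps)

lemma sup_on_flag_weight:
  fixes E :: "'n::finite set"
  assumes M: "matroid_on E \<B>" and "T \<subseteq> S"
  shows "sup_on (flag_weight T S) (rel_interior (matroid_polytope \<B>)) =
    real ((CARD('n) + 1) * matroid_rank \<B> T + matroid_rank \<B> S)"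
proof -
  let ?w = "flag_weight T S"
  have ne: "\<B> \<noteq> {}" using M by (simp add: matroid_on_def)
  have "sup_on ?w (rel_interior (matroid_polytope \<B>)) = Max ((\<bullet>) ?w ` indicator_vec ` \<B>)"
    unfolding matroid_polytope_def
    by (rule sup_on_rel_interior_convex_hull) (use ne in auto)
  also have "\<dots> = real ((CARD('n) + 1) * matroid_rank \<B> T + matroid_rank \<B> S)"
  proof (rule Max_eqI)
    fix y assume "y \<in> (\<bullet>) ?w ` indicator_vec ` \<B>"
    then obtain B where B: "B \<in> \<B>" "y = ?w \<bullet> indicator_vec B" by blast
    have "(CARD('n) + 1) * card (B \<inter> T) + card (B \<inter> S)
        \<le> (CARD('n) + 1) * matroid_rank \<B> T + matroid_rank \<B> S"
      by (intro add_mono mult_le_mono2 card_Int_le_matroid_rank[OF M B(1)])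
    then show "y \<le> real ((CARD('n) + 1) * matroid_rank \<B> T + matroid_rank \<B> S)"
      unfolding B(2) inner_flag_weight by (rule of_nat_mono)
  next
    obtain B where "B \<in> \<B>" "card (B \<inter> T) = matroid_rank \<B> T" "card (B \<inter> S) = matroid_rank \<B> S"
      using matroid_rank_chain_attained[OF assms] .
    then show "real ((CARD('n) + 1) * matroid_rank \<B> T + matroid_rank \<B> S) \<in>
        (\<bullet>) ?w ` indicator_vec ` \<B>"
      using inner_flag_weight[of T S B] by (intro image_eqI[of _ _ "indicator_vec B"]) auto
  qed simp
  finally show ?thesis .
qed

text \<open>
  Division with remainder by \<open>CARD('n) + 1\<close> recovers the two ranks. The same function \<open>\<phi>\<close> works for
  all matroids on \<open>E\<close>, as the valuative identity compares several of them.
\<close>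

lemma flag_rank_function_of_sup:
  fixes E :: "'n::finite set" and g :: "nat \<Rightarrow> nat \<Rightarrow> 'b"
  assumes "T \<subseteq> S"
  shows "\<exists>\<phi> :: real \<Rightarrow> 'b. \<forall>\<B>. matroid_on E \<B> \<longrightarrow>
       g (matroid_rank \<B> T) (matroid_rank \<B> S) =
       \<phi> (sup_on (flag_weight T S) (rel_interior (matroid_polytope \<B>)))"
proof (intro exI[of _ "\<lambda>r. g (nat \<lfloor>r\<rfloor> div (CARD('n) + 1)) (nat \<lfloor>r\<rfloor> mod (CARD('n) + 1))"]
    allI impI)
  fix \<B> :: "'n set set"
  assume M: "matroid_on E \<B>"
  let ?q = "matroid_rank \<B> T" and ?r = "matroid_rank \<B> S"
  have "card S \<le> CARD('n)" by (simp add: card_mono)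
  then have "?r < CARD('n) + 1"
    using matroid_rank_le_card[OF M, of S] by simp
  then have "((CARD('n) + 1) * ?q + ?r) div (CARD('n) + 1) = ?q"
    "((CARD('n) + 1) * ?q + ?r) mod (CARD('n) + 1) = ?r"
    by (simp_all only: div_mult_self4 mod_mult_self4 div_less mod_less)
  moreover have "nat \<lfloor>sup_on (flag_weight T S) (rel_interior (matroid_polytope \<B>))\<rfloor> =
      (CARD('n) + 1) * ?q + ?r"
    unfolding sup_on_flag_weight[OF M assms] floor_of_nat nat_int ..
  ultimately show "g ?q ?r =
      g (nat \<lfloor>sup_on (flag_weight T S) (rel_interior (matroid_polytope \<B>))\<rfloor> div (CARD('n) + 1))
        (nat \<lfloor>sup_on (flag_weight T S) (rel_interior (matroid_polytope \<B>))\<rfloor> mod (CARD('n) + 1))"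
    by simp
qed

lemma sum_internal_matroids:
  assumes D: "matroidal_subdivision E \<D> P"
  shows "(\<Sum>\<N> | matroid_on E \<N> \<and> matroid_polytope \<N> \<in> internal_faces \<D> P.
            h (matroid_polytope \<N>)) = sum h (internal_faces \<D> P)"
proof -
  let ?I = "{\<N>. matroid_on E \<N> \<and> matroid_polytope \<N> \<in> internal_faces \<D> P}"
  have inj: "inj_on matroid_polytope ?I"
    by (rule inj_onI) (metis matroid_polytope_subset_iff order_refl subset_antisym)
  have "matroid_polytope ` ?I = internal_faces \<D> P"
  proof
    show "internal_faces \<D> P \<subseteq> matroid_polytope ` ?I"
    proof
      fix C assume C: "C \<in> internal_faces \<D> P"
      then obtain \<N> where "matroid_on E \<N>" "C = matroid_polytope \<N>"
        using D unfolding matroidal_subdivision_def internal_faces_def by blast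
      with C show "C \<in> matroid_polytope ` ?I" by blast
    qed
  qed blast
  then show ?thesis
    using sum.reindex[OF inj, of h] by simp
qed

lemma flag_rank_valuative:
  fixes E :: "'n::finite set" and g :: "nat \<Rightarrow> nat \<Rightarrow> int"
  assumes M: "matroid_on E \<M>" and D: "matroidal_subdivision E \<D> (matroid_polytope \<M>)"
    and "T \<subseteq> S"
  shows "(\<Sum>\<N> | matroid_on E \<N> \<and> matroid_polytope \<N> \<in> internal_faces \<D> (matroid_polytope \<M>).
            euler_sign (matroid_polytope \<N>) * g (matroid_rank \<N> T) (matroid_rank \<N> S)) =
         euler_sign (matroid_polytope \<M>) * g (matroid_rank \<M> T) (matroid_rank \<M> S)"
    (is "?lhs = _")
proof -
  let ?P = "matroid_polytope \<M>" and ?w = "flag_weight T S"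
  obtain \<phi> where \<phi>: "\<And>\<B>. matroid_on E \<B> \<Longrightarrow>
      g (matroid_rank \<B> T) (matroid_rank \<B> S) =
      \<phi> (sup_on ?w (rel_interior (matroid_polytope \<B>)))"
    using flag_rank_function_of_sup[OF assms(3), where g = g and E = E] by blast
  have "?lhs = (\<Sum>\<N> | matroid_on E \<N> \<and> matroid_polytope \<N> \<in> internal_faces \<D> ?P.
      euler_sign (matroid_polytope \<N>) * \<phi> (sup_on ?w (rel_interior (matroid_polytope \<N>))))"
    by (rule sum.cong) (simp_all add: \<phi>)
  also have "\<dots> = (\<Sum>C\<in>internal_faces \<D> ?P. euler_sign C * \<phi> (sup_on ?w (rel_interior C)))"
    by (rule sum_internal_matroids[OF D])
  also have "\<dots> = euler_sign ?P * \<phi> (sup_on ?w (rel_interior ?P))"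
  proof -
    have "polytopal_subdivision \<D> ?P"
      using D by (simp add: matroidal_subdivision_def)
    moreover have "?P \<noteq> {}"
      using M by (simp add: matroid_polytope_def matroid_on_def)
    ultimately show ?thesis
      using sum_sup_on_internal_faces[of \<D> ?P \<phi> ?w] polytope_matroid_polytope[of \<M>]
      by simp
  qed
  finally show ?thesis by (simp add: \<phi>[OF M])
qed

text \<open>
  The cells have the same rank as \<open>M\<close>, because their bases are bases of \<open>M\<close>. With the rank \<open>k\<close> fixed,
  each term of the sum over chains is a function of \<open>rk T\<close> and \<open>rk S\<close> alone.
\<close>

lemma valuative_ec:
  fixes E :: "'n::finite set"
  shows "valuative E (ec E)"
  unfolding valuative_def
proof (intro allI impI)
  fix \<M> \<D>
  assume *: "matroid_on E \<M> \<and> matroidal_subdivision E \<D> (matroid_polytope \<M>)"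
  then have M: "matroid_on E \<M>" and D: "matroidal_subdivision E \<D> (matroid_polytope \<M>)"
    by auto
  let ?e = "\<lambda>\<N>. euler_sign (matroid_polytope \<N> :: (real ^ 'n) set)"
  let ?I = "{\<N>. matroid_on E \<N> \<and> matroid_polytope \<N> \<in> internal_faces \<D> (matroid_polytope \<M>)}"
  define k where "k = matroid_rank \<M> E"
  define g where
    "g T q r = (int k - int r) * (int (card T) - int q)" for T :: "'n set" and q r
  define f where "f \<N> = (\<Sum>S\<in>Pow E. \<Sum>T\<in>Pow S. (-1) ^ (card S - card T) *
      g T (matroid_rank \<N> T) (matroid_rank \<N> S))" for \<N>
  have ec: "ec E \<N> = f \<N>" if "matroid_rank \<N> E = k" for \<N>
    unfolding ec_eq_sum_chains f_def g_def nullity_def that ..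
  have rank: "matroid_rank \<N> E = k" if "\<N> \<in> ?I" for \<N>
  proof -
    have N: "matroid_on E \<N>" using that by simp
    have "\<Union>\<D> = matroid_polytope \<M>"
      using D by (simp add: matroidal_subdivision_def polytopal_subdivision_def)
    then have "matroid_polytope \<N> \<subseteq> matroid_polytope \<M>"
      using that by (auto simp: internal_faces_def)
    then have "\<N> \<subseteq> \<M>" by (simp add: matroid_polytope_subset_iff)
    moreover obtain B where "B \<in> \<N>" using N by (auto simp: matroid_on_def)
    ultimately show ?thesis
      using matroid_rank_ground[OF N] matroid_rank_ground[OF M] by (auto simp: k_def)
  qed
  have sign: "(if even (aff_dim (matroid_polytope \<M>) - aff_dim (matroid_polytope \<N>))
      then x else - x) = ?e \<M> * (?e \<N> * x)" for \<N> and x :: int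
    by (simp add: euler_sign_def)
  have "(\<Sum>\<N>\<in>?I. ?e \<N> * f \<N>) = (\<Sum>S\<in>Pow E. \<Sum>T\<in>Pow S. (-1) ^ (card S - card T) *
      (\<Sum>\<N>\<in>?I. ?e \<N> * g T (matroid_rank \<N> T) (matroid_rank \<N> S)))"
    unfolding f_def sum_distrib_left
    by (subst sum.swap, rule sum.cong[OF refl], subst sum.swap, rule sum.cong[OF refl],
        rule sum.cong[OF refl], rule mult.left_commute)
  also have "\<dots> = (\<Sum>S\<in>Pow E. \<Sum>T\<in>Pow S. (-1) ^ (card S - card T) *
      (?e \<M> * g T (matroid_rank \<M> T) (matroid_rank \<M> S)))"
    by (rule sum.cong[OF refl], rule sum.cong[OF refl]) (simp add: flag_rank_valuative[OF M D])
  also have "\<dots> = ?e \<M> * f \<M>"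
    unfolding f_def sum_distrib_left
    by (rule sum.cong[OF refl], rule sum.cong[OF refl], rule mult.left_commute)
  finally have eq: "(\<Sum>\<N>\<in>?I. ?e \<N> * f \<N>) = ?e \<M> * f \<M>" .
  have "ec E \<M> = ?e \<M> * (?e \<M> * f \<M>)"
    by (simp add: ec k_def euler_sign_def)
  also have "\<dots> = (\<Sum>\<N>\<in>?I. ?e \<M> * (?e \<N> * ec E \<N>))"
    unfolding eq[symmetric] sum_distrib_left
    by (rule sum.cong[OF refl]) (simp only: ec[OF rank])
  finally show "ec E \<M> = (\<Sum>\<N>\<in>?I.
      if even (aff_dim (matroid_polytope \<M>) - aff_dim (matroid_polytope \<N>))
      then ec E \<N> else - ec E \<N>)"
    unfolding sign .
qed

theorem theorem5p3:
  fixes E :: "'n::finite set"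
  shows "matroid_invariant (ec :: 'n set \<Rightarrow> 'n set set \<Rightarrow> int) \<and> valuative E (ec E)"
  using matroid_invariant_ec valuative_ec by blast

end
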